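(* Fix $s\in\mathbb{N}$. There exists a subadditive density $d$ on $\mathbb{N}$ such that, for every $E\subseteq\mathbb{N}$ with $d(E)>0$ and every polynomial $P\in\mathbb{Z}[y]$ satisfying $P(0)=0$, there exist $x,y\in\mathbb{N}$ with $x>y\geq 2$ such that $$\{x,\;x+P(y),\;xy^s\}\subseteq E.$$
   Context: $\mathbb{N}=\{1,2,3,\ldots\}$. Let $2^{\mathbb{N}}$ denote the power set of $\mathbb{N}$. A subadditive density on $\mathbb{N}$ is a function $D\colon 2^{\mathbb{N}}\to[0,1]$ satisfying $D(\emptyset)=0$ and $D(\mathbb{N})=1$, which is monotone ($D(A)\leq D(B)$ whenever $A\subseteq B$) and subadditive ($D(A\cup B)\leq D(A)+D(B)$ for all $A,B\subseteq\mathbb{N}$). *)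

theory Defs
  imports Complex_Main "HOL-Library.FuncSet" "HOL-Computational_Algebra.Polynomial"
begin

text \<open>
  The positive integers are the subset \<open>{1..}\<close> of type \<open>nat\<close>. A density is a function on
  \<open>Pow {1..}\<close>; its values on sets containing \<open>0\<close> are unconstrained and irrelevant.
\<close>

definition subadditive_density :: "(nat set \<Rightarrow> real) \<Rightarrow> bool" where
  "subadditive_density D \<longleftrightarrow>
     D \<in> Pow {1..} \<rightarrow> {0..1} \<and>
     D {} = 0 \<and> D {1..} = 1 \<and>
     (\<forall>A B. A \<subseteq> B \<and> B \<subseteq> {1..} \<longrightarrow> D A \<le> D B) \<and>
     (\<forall>A B. A \<subseteq> {1..} \<and> B \<subseteq> {1..} \<longrightarrow> D (A \<union> B) \<le> D A + D B)"

end

theory Submission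
  imports Defs "HOL-Library.Multiset"
begin

text \<open>
  The density takes only the values 0 and 1. Call a set \<open>E\<close> of positive integers bad if for some
  polynomial \<open>P\<close> with \<open>P 0 = 0\<close> it contains no configuration
  \<open>{x, x + P y, x y\<^sup>s}\<close> with \<open>x > y \<ge> 2\<close>, and give density 0 exactly to the sets covered by
  finitely many bad sets. Monotonicity and subadditivity are then immediate, and a set of positive
  density is not bad. What has to be shown is that finitely many bad sets never cover the positive
  integers. Since a finite cover uses only finitely many polynomials, this is a colouring theorem
  (\<open>monochromatic_sums_and_products\<close>): for every finite cover and every finite set \<open>G\<close> of such
  polynomials, one class contains \<open>x\<close>, \<open>x y\<^sup>s\<close> and all \<open>x + f y\<close> with \<open>f \<in> G\<close>.

  The colouring theorem follows an argument of Moreira with piecewise syndetic sets. These have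
  three properties: if a finite union is piecewise syndetic then so is one of its parts; dilates of
  piecewise syndetic sets are piecewise syndetic; and for a piecewise syndetic \<open>B\<close> and a finite set
  \<open>F\<close> of polynomials vanishing at 0 there is \<open>n \<ge> 1\<close> such that the points \<open>u \<in> B\<close> with all
  \<open>u + p n \<in> B\<close>, for \<open>p \<in> F\<close>, form a piecewise syndetic set. One alternates the three: shrink
  \<open>B\<close> to such a set of returns, dilate by \<open>n\<^sup>s\<close>, and intersect with a colour class. Every new set
  sits in \<open>n\<^sup>s\<close> times its predecessor, so after finitely many rounds a colour recurs, and the product
  of the \<open>n\<close> used between its two occurrences is the desired \<open>y\<close>. The polynomials in \<open>F\<close> are
  rescaled to anticipate this product.

  The return property is deduced from the polynomial van der Waerden theorem, proved here by
  Walters' colour focusing inside an induction on finite sets of polynomials: differencing all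
  polynomials against one of least degree trades one leading term for others of lower degree, which
  decreases the multiset of degrees of the leading terms that occur.
\<close>

section \<open>Differencing polynomials\<close>

text \<open>
  The correction by which the point \<open>a + p e\<close> has to be moved when the base point \<open>a\<close> is replaced by
  \<open>a - q n\<close> and the argument \<open>e\<close> by \<open>n + e\<close>.
\<close>

definition derived_poly :: "int poly \<Rightarrow> int poly \<Rightarrow> int \<Rightarrow> int poly" where
  "derived_poly q p e = pcompose p [:e, 1:] - [:poly p e:] - q"

lemma poly_derived_poly:
  "poly (derived_poly q p e) n = poly p (n + e) - poly p e - poly q n"
  by (simp add: derived_poly_def poly_pcompose add.commute)

text \<open>
  Two polynomials of the same degree are distinguished only if their leading coefficients differ:
  subtracting \<open>q\<close> from a polynomial lowers the degree exactly when both have the same degree and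
  leading coefficient.
\<close>

definition leading_types :: "int poly set \<Rightarrow> (nat \<times> int) set" where
  "leading_types F = (\<lambda>p. (degree p, lead_coeff p)) ` (F - {0})"

lemma degree_pos_of_root_0:
  fixes p :: "int poly"
  assumes "poly p 0 = 0" "p \<noteq> 0"
  shows "degree p > 0"
proof (rule ccontr)
  assume "\<not> degree p > 0"
  then obtain c where "p = [:c:]" using degree_eq_zeroE by blast
  with assms show False by simp
qed

text \<open>
  The shift by \<open>e\<close> and the constant term do not affect the coefficient of \<open>p\<close> in its own degree,
  which is positive. So only the subtraction of \<open>q\<close> matters at the top.
\<close>

lemma derived_poly_leading_type:
  fixes p q :: "int poly" and e :: int
  assumes p: "poly p 0 = 0" "p \<noteq> 0" and q: "q \<noteq> 0" and deg: "degree q \<le> degree p"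
  defines "r \<equiv> derived_poly q p e"
  assumes r: "r \<noteq> 0"
  shows "degree q = degree p \<and> lead_coeff q = lead_coeff p \<and> degree r < degree q \<or>
    degree q = degree p \<and> lead_coeff q \<noteq> lead_coeff p \<and>
      degree r = degree q \<and> lead_coeff r = lead_coeff p - lead_coeff q \<or>
    degree q < degree p \<and> degree r = degree p \<and> lead_coeff r = lead_coeff p"
proof -
  have dp: "degree p > 0" using p by (rule degree_pos_of_root_0)
  have "degree (pcompose p [:e, 1:]) = degree p"
    by (simp add: degree_pcompose)
  moreover have "lead_coeff (pcompose p [:e, 1:]) = lead_coeff p"
    by (subst lead_coeff_comp) auto
  ultimately have c: "coeff (pcompose p [:e, 1:]) (degree p) = lead_coeff p"
    and c0: "\<And>i. i > degree p \<Longrightarrow> coeff (pcompose p [:e, 1:]) i = 0"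
    by (simp_all add: coeff_eq_0)
  have "coeff [:poly p e:] i = 0" if "i \<ge> degree p" for i
    using dp that by (cases i) auto
  then have top: "coeff r (degree p) = lead_coeff p - coeff q (degree p)"
    and above: "\<And>i. i > degree p \<Longrightarrow> coeff r i = 0"
    using c c0 deg by (auto simp: r_def derived_poly_def coeff_eq_0)
  have le: "degree r \<le> degree p" using above by (meson degree_le)
  show ?thesis
  proof (cases "degree q = degree p")
    case True
    show ?thesis
    proof (cases "lead_coeff q = lead_coeff p")
      case eq: True
      then have "coeff r (degree p) = 0" using top True by simp
      with r le have "degree r \<noteq> degree p" by (metis leading_coeff_0_iff)
      with le True eq show ?thesis by auto
    next
      case False
      then have "coeff r (degree p) \<noteq> 0" using top True by simp
      then have "degree r = degree p" using le le_degree by (metis le_antisym)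
      with False True top show ?thesis by auto
    qed
  next
    case False
    then have lt: "degree q < degree p" using deg by simp
    then have t: "coeff r (degree p) = lead_coeff p" using top by (simp add: coeff_eq_0)
    then have "degree r = degree p" using p le le_degree[of r "degree p"] by (simp)
    with t lt show ?thesis by auto
  qed
qed

text \<open>
  The induction measure: the degree of each leading term, repeated for each leading coefficient
  occurring with it. It is compared by the multiset extension of the order on \<open>nat\<close>.
\<close>

definition type_degrees :: "(nat \<times> int) set \<Rightarrow> nat multiset" where
  "type_degrees S = image_mset fst (mset_set S)"

text \<open>
  Removing a type of degree \<open>D\<close> pays for arbitrarily many types \<open>K\<close> of smaller degree, while a
  degree-preserving injection \<open>\<phi>\<close> leaves the count of the remaining types alone.
\<close>

lemma type_degrees_replace_less:
  assumes S: "finite S" "(D, l) \<in> S" and K: "finite K" "\<And>t. t \<in> K \<Longrightarrow> fst t < D"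
    and \<phi>: "inj \<phi>" "\<And>t. fst (\<phi> t) = fst t"
  shows "(type_degrees (\<phi> ` (S - {(D, l)}) \<union> K), type_degrees S) \<in> mult {(x, y). x < y}"
proof -
  define T where "T = S - {(D, l)}"
  have fT: "finite T" using S by (simp add: T_def)
  have "mset_set (\<phi> ` T \<union> K) = mset_set (\<phi> ` T) + mset_set (K - \<phi> ` T)"
    using fT K by (subst mset_set_Union[symmetric]) auto
  moreover have "mset_set (\<phi> ` T) = image_mset \<phi> (mset_set T)"
    using \<phi> by (intro image_mset_mset_set[symmetric]) (auto intro: inj_on_subset)
  ultimately have 1: "type_degrees (\<phi> ` T \<union> K) =
      image_mset fst (mset_set T) + image_mset fst (mset_set (K - \<phi> ` T))"
    using \<phi>(2) by (simp add: type_degrees_def multiset.map_comp comp_def)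
  have "mset_set S = add_mset (D, l) (mset_set T)"
    using S mset_set.remove[of S "(D,l)"] by (simp add: T_def)
  then have 2: "type_degrees S = image_mset fst (mset_set T) + {#D#}"
    by (simp add: type_degrees_def)
  show ?thesis unfolding T_def[symmetric] 1 2
    using K by (intro one_step_implies_mult) auto
qed

section \<open>The polynomial van der Waerden theorem\<close>

text \<open>
  The polynomial van der Waerden property of \<open>F\<close>. The bound \<open>N\<close> does not depend on the colouring;
  this uniformity is what lets colourings of intervals serve as colours in their own right, and
  what transfers the property to long intervals of a piecewise syndetic set.
\<close>

definition poly_vdw :: "int poly set \<Rightarrow> bool" where
  "poly_vdw F \<longleftrightarrow> (\<forall>k. \<exists>N. \<forall>\<chi> :: int \<Rightarrow> nat. (\<forall>x. \<chi> x < k) \<longrightarrow>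
     (\<exists>a d. \<bar>a\<bar> \<le> N \<and> 1 \<le> d \<and> d \<le> N \<and> (\<forall>p\<in>F. \<chi> (a + poly p d) = \<chi> a)))"

lemma poly_vdwE:
  assumes "poly_vdw F"
  obtains N where "\<forall>\<chi> :: int \<Rightarrow> nat. (\<forall>x. \<chi> x < k) \<longrightarrow>
    (\<exists>a d. \<bar>a\<bar> \<le> N \<and> 1 \<le> d \<and> d \<le> N \<and> (\<forall>p\<in>F. \<chi> (a + poly p d) = \<chi> a))"
  by (rule exE[OF spec[OF assms[unfolded poly_vdw_def], of k]]) (rule that)

lemma poly_bound_on_interval:
  fixes F :: "int poly set"
  assumes "finite F"
  obtains M where "M \<ge> 0" "\<And>p d. p \<in> F \<Longrightarrow> 1 \<le> d \<Longrightarrow> d \<le> N \<Longrightarrow> \<bar>poly p d\<bar> \<le> M"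
proof
  let ?S = "(\<lambda>(p, d). \<bar>poly p d\<bar>) ` (F \<times> {1..N})"
  have fin: "finite (insert 0 ?S)" using assms by simp
  show "Max (insert 0 ?S) \<ge> 0" using fin by (intro Max_ge) auto
  show "\<bar>poly p d\<bar> \<le> Max (insert 0 ?S)" if "p \<in> F" "1 \<le> d" "d \<le> N" for p d
    using fin that by (intro Max_ge) force+
qed

text \<open>
  Colour focusing. Suppose the points \<open>a + p d\<close>, for \<open>p \<in> G\<close>, have one colour \<open>c d\<close> for each of
  \<open>r\<close> arguments \<open>d \<in> D\<close>, with distinct colours for distinct \<open>d\<close>. By induction on \<open>r\<close>,
  every colouring has such a configuration near 0, unless it has a solution there, that is, a point
  sharing its colour with its translates by all \<open>p d\<close> for one \<open>d\<close>. For the step, apply the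
  property for the derived polynomials to the colouring of base points by the pattern of colours
  around them: this yields \<open>b\<close> and \<open>n\<close> such that moving by any derived polynomial at \<open>n\<close>
  preserves the pattern around \<open>b\<close>. Near \<open>b\<close> take a configuration \<open>b + a + p d\<close> for \<open>r\<close>.
  If the colour of \<open>b + a\<close> is one of the \<open>c d\<close>, this is a solution. Otherwise
  \<open>b + a - q n\<close> is a focus for the \<open>r + 1\<close> arguments \<open>n\<close> and \<open>n + d\<close>, the new one
  carrying the colour of \<open>b + a\<close>. With \<open>k\<close> colours this cannot go on beyond \<open>r = k\<close>.
\<close>

lemma poly_vdw_step:
  fixes G :: "int poly set"
  assumes fin: "finite G" and q: "q \<in> G"
    and z: "\<And>p. p \<in> G \<Longrightarrow> poly p 0 = 0"
    and IH: "\<And>N. poly_vdw ((\<lambda>(p, e). derived_poly q p e) ` (G \<times> {0..N}))"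
  shows "poly_vdw G"
  unfolding poly_vdw_def
proof
  fix k
  define found where "found \<chi> N \<longleftrightarrow>
      (\<exists>a d. \<bar>a\<bar> \<le> N \<and> 1 \<le> d \<and> d \<le> N \<and> (\<forall>p\<in>G. \<chi> (a + poly p d) = \<chi> a))"
    for \<chi> :: "int \<Rightarrow> nat" and N
  define focused where "focused \<chi> N a D c \<longleftrightarrow> \<bar>a\<bar> \<le> N \<and> finite D \<and> D \<subseteq> {1..N} \<and> inj_on c D \<and>
      (\<forall>d\<in>D. \<forall>p\<in>G. \<chi> (a + poly p d) = c d)"
    for \<chi> :: "int \<Rightarrow> nat" and N a D and c :: "int \<Rightarrow> nat"
  have "\<exists>N. \<forall>\<chi>. (\<forall>x. \<chi> x < k) \<longrightarrow> found \<chi> N \<or> (\<exists>a D c. focused \<chi> N a D c \<and> card D = r)" for r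
  proof (induction r)
    case 0
    have "focused \<chi> 0 0 {} (\<lambda>_. 0)" for \<chi> by (simp add: focused_def)
    then show ?case by (metis card.empty)
  next
    case (Suc r)
    then obtain N where N: "\<And>\<chi>. (\<forall>x. \<chi> x < k) \<Longrightarrow>
        found \<chi> N \<or> (\<exists>a D c. focused \<chi> N a D c \<and> card D = r)" by blast
    obtain M where M: "M \<ge> 0" "\<And>p d. p \<in> G \<Longrightarrow> 1 \<le> d \<Longrightarrow> d \<le> N \<Longrightarrow> \<bar>poly p d\<bar> \<le> M"
      using poly_bound_on_interval[OF fin] by metis
    \<comment> \<open>Radius of a block containing every point that the focused configuration at hand may use.\<close>
    define R where "R = \<bar>N\<bar> + M"
    \<comment> \<open>The possible colourings of a block, numbered by \<open>h\<close> so that they can serve as colours.\<close>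
    define S where "S = PiE {-R..R} (\<lambda>_. {..<k})"
    have "finite S" unfolding S_def by (intro finite_PiE) auto
    then obtain h where h: "bij_betw h S {0..<card S}"
      using ex_bij_betw_finite_nat by blast
    let ?F = "(\<lambda>(p, e). derived_poly q p e) ` (G \<times> {0..N})"
    obtain N' where N': "\<forall>\<chi> :: int \<Rightarrow> nat. (\<forall>x. \<chi> x < card S) \<longrightarrow>
        (\<exists>b n. \<bar>b\<bar> \<le> N' \<and> 1 \<le> n \<and> n \<le> N' \<and> (\<forall>p\<in>?F. \<chi> (b + poly p n) = \<chi> b))"
      by (rule poly_vdwE[OF IH[of N], of "card S"])
    obtain Q where Q: "Q \<ge> 0" "\<And>p n. p \<in> G \<Longrightarrow> 1 \<le> n \<Longrightarrow> n \<le> N' \<Longrightarrow> \<bar>poly p n\<bar> \<le> Q"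
      using poly_bound_on_interval[OF fin] by metis
    define N'' where "N'' = \<bar>N\<bar> + N' + Q"
    have bound: "found \<chi> N'' \<or> (\<exists>a D c. focused \<chi> N'' a D c \<and> card D = Suc r)"
      if \<chi>: "\<forall>x. \<chi> x < k" for \<chi>
    proof -
      define blk where "blk b = restrict (\<lambda>i. \<chi> (b + i)) {-R..R}" for b
      have blk: "blk b \<in> S" for b using \<chi> by (auto simp: blk_def S_def)
      then have "\<forall>b. h (blk b) < card S" using h by (auto simp: bij_betw_def)
      from mp[OF spec[OF N'] this] obtain b n where b: "\<bar>b\<bar> \<le> N'" "1 \<le> n" "n \<le> N'"
        and eq: "\<And>p. p \<in> ?F \<Longrightarrow> h (blk (b + poly p n)) = h (blk b)" by blast
      have shift: "\<chi> (b + poly (derived_poly q p e) n + i) = \<chi> (b + i)"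
        if "p \<in> G" "0 \<le> e" "e \<le> N" "\<bar>i\<bar> \<le> R" for p e i
      proof -
        have "derived_poly q p e \<in> ?F" using that by force
        from eq[OF this] have "blk (b + poly (derived_poly q p e) n) = blk b"
          using h blk by (meson bij_betw_def inj_onD)
        from fun_cong[OF this, of i] show ?thesis using that by (simp add: blk_def abs_le_iff)
      qed
      have "\<forall>x. \<chi> (b + x) < k" using \<chi> by simp
      from N[OF this] show ?thesis
      proof
        assume "found (\<lambda>x. \<chi> (b + x)) N"
        then obtain a d where ad: "\<bar>a\<bar> \<le> N" "1 \<le> d" "d \<le> N"
            "\<forall>p\<in>G. \<chi> (b + (a + poly p d)) = \<chi> (b + a)" unfolding found_def by blast
        then have "found \<chi> N''" unfolding found_def
          using b Q(1) by (intro exI[of _ "b + a"] exI[of _ d]) (auto simp: N''_def add.assoc)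
        then show ?thesis ..
      next
        assume "\<exists>a D c. focused (\<lambda>x. \<chi> (b + x)) N a D c \<and> card D = r"
        then obtain a D c where foc: "\<bar>a\<bar> \<le> N" "finite D" "D \<subseteq> {1..N}" "inj_on c D" "card D = r"
          and col: "\<And>d p. d \<in> D \<Longrightarrow> p \<in> G \<Longrightarrow> \<chi> (b + (a + poly p d)) = c d"
          unfolding focused_def by blast
        show ?thesis
        proof (cases "\<chi> (b + a) \<in> c ` D")
          case True
          then obtain d where d: "d \<in> D" "\<chi> (b + a) = c d" by blast
          then have "1 \<le> d" "d \<le> N" using foc by auto
          with d have "found \<chi> N''" unfolding found_def
            using b Q(1) foc col by (intro exI[of _ "b + a"] exI[of _ d]) (auto simp: N''_def add.assoc)
          then show ?thesis ..
        next
          case False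
          define a' where "a' = b + a - poly q n"
          define D' where "D' = (+) n ` insert 0 D"
          \<comment> \<open>The argument \<open>n\<close> is the shift of \<open>d = 0\<close>, where all \<open>a + p 0\<close> equal \<open>a\<close>.\<close>
          define c' where "c' e = (if e = n then \<chi> (b + a) else c (e - n))" for e
          have "0 \<notin> D" using foc by auto
          have "card D' = card (insert 0 D)" unfolding D'_def by (rule card_image) (rule inj_on_add)
          then have card: "card D' = Suc r" using foc \<open>0 \<notin> D\<close> by simp
          have c'D: "(c' \<circ> (+) n) d = c d" if "d \<in> D" for d
            using that \<open>0 \<notin> D\<close> by (auto simp: c'_def)
          then have "inj_on (c' \<circ> (+) n) D" using foc(4) inj_on_cong by blast
          moreover have "(c' \<circ> (+) n) ` D = c ` D" using c'D by (rule image_cong[OF refl])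
          ultimately have "inj_on (c' \<circ> (+) n) (insert 0 D)"
            using False \<open>0 \<notin> D\<close> unfolding inj_on_insert by (simp add: c'_def)
          then have inj: "inj_on c' D'" unfolding D'_def by (rule inj_on_imageI)
          have "\<chi> (a' + poly p (n + d)) = c' (n + d)" if "d \<in> insert 0 D" "p \<in> G" for d p
          proof -
            have N0: "0 \<le> N" using foc(1) by linarith
            have d: "0 \<le> d" "d \<le> N" using that foc N0 by auto
            have "\<bar>poly p d\<bar> \<le> M"
            proof (cases "d = 0")
              case True
              then show ?thesis using M(1) z[OF that(2)] by simp
            next
              case False
              then show ?thesis using M(2)[OF that(2), of d] d by simp
            qed
            then have "\<bar>a + poly p d\<bar> \<le> R" using foc(1) by (simp add: R_def)
            from shift[OF that(2) d this]
            have "\<chi> (a' + poly p (n + d)) = \<chi> (b + (a + poly p d))"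
              by (simp add: a'_def poly_derived_poly algebra_simps)
            then show ?thesis using col that z by (auto simp: c'_def)
          qed
          then have "\<forall>e\<in>D'. \<forall>p\<in>G. \<chi> (a' + poly p e) = c' e" unfolding D'_def by blast
          moreover have "\<bar>a'\<bar> \<le> N''"
            using foc(1) b Q(2)[OF q, of n] by (simp add: a'_def N''_def)
          moreover have "finite D'" "D' \<subseteq> {1..N''}"
            using foc b Q(1) by (auto simp: D'_def N''_def)
          ultimately have "focused \<chi> N'' a' D' c'" using inj unfolding focused_def by blast
          with card show ?thesis by blast
        qed
      qed
    qed
    show ?case by (rule exI[of _ N''], intro allI impI, rule bound)
  qed
  from this[of "Suc k"] obtain N where N: "\<And>\<chi>. (\<forall>x. \<chi> x < k) \<Longrightarrow>
      found \<chi> N \<or> (\<exists>a D c. focused \<chi> N a D c \<and> card D = Suc k)" by blast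
  have "found \<chi> N" if \<chi>: "\<forall>x. \<chi> x < k" for \<chi>
    using N[OF \<chi>]
  proof
    assume "\<exists>a D c. focused \<chi> N a D c \<and> card D = Suc k"
    then obtain a D c where D: "focused \<chi> N a D c" "card D = Suc k" by (elim exE conjE)
    have "c d < k" if "d \<in> D" for d
    proof -
      have "c d = \<chi> (a + poly q d)" using D(1) q that by (simp add: focused_def)
      then show ?thesis using \<chi> by simp
    qed
    then have "c ` D \<subseteq> {..<k}" by blast
    then have "card D \<le> k" using D(1) unfolding focused_def
      by (metis card_inj_on_le card_lessThan finite_lessThan)
    with D(2) show ?thesis by simp
  qed
  then show "\<exists>N. \<forall>\<chi>. (\<forall>x. \<chi> x < k) \<longrightarrow> (\<exists>a d. \<bar>a\<bar> \<le> N \<and> 1 \<le> d \<and> d \<le> N \<and>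
      (\<forall>p\<in>G. \<chi> (a + poly p d) = \<chi> a))"
    unfolding found_def by blast
qed


text \<open>
  Induction on the multiset of degrees. The set \<open>S\<close> bounds the leading types instead of being equal to
  them, so that an upper bound for the types of the derived polynomials suffices. The polynomial
  \<open>q\<close> must have least degree: then only the types in that degree are shifted, by the leading
  coefficient \<open>l\<close> of \<open>q\<close>, those above are unchanged, and the type of \<open>q\<close> itself is replaced by
  types of lower degree.
\<close>

theorem polynomial_van_der_Waerden:
  assumes "finite F" "\<And>p. p \<in> F \<Longrightarrow> poly p 0 = 0"
  shows "poly_vdw F"
proof -
  define r where "r = inv_image (mult {(x :: nat, y). x < y}) type_degrees"
  have wf: "wf r" unfolding r_def by (intro wf_inv_image wf_mult wf)
  have "\<forall>F. finite F \<longrightarrow> (\<forall>p\<in>F. poly p 0 = 0) \<longrightarrow> leading_types F \<subseteq> S \<longrightarrow> poly_vdw F"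
    if "finite S" for S
    using wf that
  proof (induction S rule: wf_induct_rule)
    case (less S)
    show ?case
    proof (intro allI impI)
      fix F :: "int poly set"
      assume F: "finite F" "\<forall>p\<in>F. poly p 0 = 0" "leading_types F \<subseteq> S"
      \<comment> \<open>The zero polynomial imposes no condition, but its derived polynomial \<open>-q\<close> would add a new type.\<close>
      define G where "G = F - {0}"
      have G: "finite G" "\<And>p. p \<in> G \<Longrightarrow> poly p 0 = 0" "\<And>p. p \<in> G \<Longrightarrow> p \<noteq> 0"
        using F by (auto simp: G_def)
      have GS: "\<And>p. p \<in> G \<Longrightarrow> (degree p, lead_coeff p) \<in> S"
        using F(3) by (auto simp: G_def leading_types_def)
      have "poly_vdw G"
      proof (cases "G = {}")
        case True
        have "\<exists>(a :: int) d :: int. \<bar>a\<bar> \<le> 1 \<and> 1 \<le> d \<and> d \<le> 1"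
          by (rule exI[of _ 0], rule exI[of _ 1]) simp
        with True show ?thesis unfolding poly_vdw_def by auto
      next
        case False
        obtain q where q: "q \<in> G" and min: "\<And>p. p \<in> G \<Longrightarrow> degree q \<le> degree p"
          using G(1) False by (metis (no_types, lifting) arg_min_if_finite(1) arg_min_least)
        define D where "D = degree q"
        define l where "l = lead_coeff q"
        define \<phi> where "\<phi> = (\<lambda>(i, c). if i = D then (i, c - l) else (i, c))"
        have \<phi>: "inj \<phi>" "\<And>t. fst (\<phi> t) = fst t"
          by (auto simp: \<phi>_def inj_def split: if_splits)
        have "poly_vdw ((\<lambda>(p, e). derived_poly q p e) ` (G \<times> {0..N}))" for N
        proof -
          define H where "H = (\<lambda>(p, e). derived_poly q p e) ` (G \<times> {0..N})"
          define K where "K = {t \<in> leading_types H. fst t < D}"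
          have H: "finite H" using G(1) by (simp add: H_def)
          then have K: "finite K" by (simp add: K_def leading_types_def)
          have root: "poly p 0 = 0" if "p \<in> H" for p
            using that G(2) q by (auto simp: H_def poly_derived_poly)
          have "leading_types H \<subseteq> \<phi> ` (S - {(D, l)}) \<union> K"
          proof
            fix t assume t: "t \<in> leading_types H"
            then obtain p e where p: "p \<in> G" "derived_poly q p e \<noteq> 0"
              and teq: "t = (degree (derived_poly q p e), lead_coeff (derived_poly q p e))"
              by (auto simp: leading_types_def H_def)
            from derived_poly_leading_type[OF G(2)[OF p(1)] G(3)[OF p(1)] G(3)[OF q] min[OF p(1)] p(2)]
            consider "fst t < D"
              | "D = degree p" "l \<noteq> lead_coeff p" "t = (D, lead_coeff p - l)"
              | "D < degree p" "t = (degree p, lead_coeff p)"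
              unfolding teq D_def l_def by auto
            then show "t \<in> \<phi> ` (S - {(D, l)}) \<union> K"
            proof cases
              case 1
              with t show ?thesis by (simp add: K_def)
            next
              case 2
              then have "t = \<phi> (degree p, lead_coeff p)" by (simp add: \<phi>_def)
              moreover have "(degree p, lead_coeff p) \<in> S - {(D, l)}" using 2 GS[OF p(1)] by auto
              ultimately show ?thesis by blast
            next
              case 3
              then have "t = \<phi> (degree p, lead_coeff p)" by (simp add: \<phi>_def)
              moreover have "(degree p, lead_coeff p) \<in> S - {(D, l)}" using 3 GS[OF p(1)] by auto
              ultimately show ?thesis by blast
            qed
          qed
          moreover have "(\<phi> ` (S - {(D, l)}) \<union> K, S) \<in> r"
            unfolding r_def in_inv_image
            using less.prems GS[OF q] K \<phi>
            by (intro type_degrees_replace_less) (auto simp: K_def D_def l_def)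
          moreover have "finite (\<phi> ` (S - {(D, l)}) \<union> K)" using less.prems K by simp
          ultimately have "poly_vdw H" using less.IH H root by blast
          then show ?thesis by (simp add: H_def)
        qed
        then show ?thesis using poly_vdw_step[OF G(1) q G(2)] by blast
      qed
      moreover have "p \<in> G \<or> p = 0" if "p \<in> F" for p using that by (simp add: G_def)
      ultimately show "poly_vdw F"
        unfolding poly_vdw_def by (metis add.right_neutral poly_0)
    qed
  qed
  moreover have "finite (leading_types F)" using assms by (simp add: leading_types_def)
  ultimately show ?thesis using assms by blast
qed

section \<open>Piecewise syndetic sets\<close>

text \<open>
  Equivalently, finitely many translates of \<open>A\<close> have a union that contains arbitrarily long
  intervals; \<open>k\<close> bounds the gaps of \<open>A\<close> in these intervals.
\<close>

definition piecewise_syndetic :: "int set \<Rightarrow> bool" where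
  "piecewise_syndetic A \<longleftrightarrow> (\<exists>k. \<forall>L. \<exists>b. \<forall>x\<in>{b..b+L}. \<exists>i\<in>{0..k}. x + i \<in> A)"

lemma not_piecewise_syndetic_empty: "\<not> piecewise_syndetic {}"
  unfolding piecewise_syndetic_def by (metis atLeastAtMost_iff empty_iff le_add_same_cancel1 order_refl)

lemma piecewise_syndetic_positive: "piecewise_syndetic {1..}"
  unfolding piecewise_syndetic_def by (rule exI[of _ 0]) (auto intro!: exI[of _ 1])

text \<open>
  On long intervals where \<open>A \<union> B\<close> has gaps at most \<open>k\<close>, either one finds arbitrarily long
  subintervals that \<open>B\<close> avoids, and there \<open>A\<close> alone has gaps at most \<open>k\<close>; or \<open>B\<close> meets
  every subinterval of some fixed length \<open>M\<close> and so has bounded gaps itself.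
\<close>

lemma piecewise_syndetic_Un:
  assumes "piecewise_syndetic (A \<union> B)"
  shows "piecewise_syndetic A \<or> piecewise_syndetic B"
proof -
  obtain k where k: "\<And>L. \<exists>b. \<forall>x\<in>{b..b+L}. \<exists>i\<in>{0..k}. x + i \<in> A \<union> B"
    using assms unfolding piecewise_syndetic_def by blast
  show ?thesis
  proof (cases "\<forall>L. \<exists>b. (\<forall>x\<in>{b..b+L}. \<exists>i\<in>{0..k}. x + i \<in> A \<union> B) \<and>
      (\<forall>x\<in>{b..b+L}. \<forall>i\<in>{0..k}. x + i \<notin> B)")
    case True
    have "piecewise_syndetic A" unfolding piecewise_syndetic_def
    proof (rule exI[of _ k], rule allI)
      fix L
      from True obtain b where "\<forall>x\<in>{b..b+L}. \<exists>i\<in>{0..k}. x + i \<in> A \<union> B"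
        "\<forall>x\<in>{b..b+L}. \<forall>i\<in>{0..k}. x + i \<notin> B" by blast
      then show "\<exists>b. \<forall>x\<in>{b..b+L}. \<exists>i\<in>{0..k}. x + i \<in> A" by blast
    qed
    then show ?thesis ..
  next
    case False
    then obtain M where M: "\<And>b. (\<forall>x\<in>{b..b+M}. \<exists>i\<in>{0..k}. x + i \<in> A \<union> B) \<Longrightarrow>
        \<exists>x\<in>{b..b+M}. \<exists>i\<in>{0..k}. x + i \<in> B" by blast
    have "piecewise_syndetic B" unfolding piecewise_syndetic_def
    proof (rule exI[of _ "M + k"], rule allI)
      fix L
      from k[of "L + M"] obtain b where b: "\<forall>x\<in>{b..b+(L+M)}. \<exists>i\<in>{0..k}. x + i \<in> A \<union> B" ..
      have "\<exists>i\<in>{0..M+k}. x + i \<in> B" if x: "x \<in> {b..b+L}" for x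
      proof -
        have "\<forall>y\<in>{x..x+M}. \<exists>i\<in>{0..k}. y + i \<in> A \<union> B" using b x by auto
        from M[OF this] obtain y i where "y \<in> {x..x+M}" "i \<in> {0..k}" "y + i \<in> B" by blast
        then show ?thesis by (intro bexI[of _ "y + i - x"]) auto
      qed
      then show "\<exists>b. \<forall>x\<in>{b..b+L}. \<exists>i\<in>{0..M+k}. x + i \<in> B" by blast
    qed
    then show ?thesis ..
  qed
qed

lemma piecewise_syndetic_UN:
  assumes "finite I" "piecewise_syndetic (\<Union>i\<in>I. A i)"
  shows "\<exists>i\<in>I. piecewise_syndetic (A i)"
  using assms
proof (induction I rule: finite_induct)
  case empty
  then show ?case by (simp add: not_piecewise_syndetic_empty)
next
  case (insert j I)
  then show ?case using piecewise_syndetic_Un[of "A j" "\<Union>i\<in>I. A i"] by auto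
qed

lemma piecewise_syndetic_dilate:
  assumes "piecewise_syndetic A" "m \<ge> 1"
  shows "piecewise_syndetic ((*) m ` A)"
proof -
  obtain k where k: "\<And>L. \<exists>b. \<forall>x\<in>{b..b+L}. \<exists>i\<in>{0..k}. x + i \<in> A"
    using assms(1) unfolding piecewise_syndetic_def by blast
  show ?thesis unfolding piecewise_syndetic_def
  proof (rule exI[of _ "m * k + m"], rule allI)
    fix L
    from k[of L] obtain b where b: "\<forall>x\<in>{b..b+L}. \<exists>i\<in>{0..k}. x + i \<in> A" ..
    have "\<exists>i\<in>{0..m*k+m}. x + i \<in> (*) m ` A" if x: "x \<in> {m*b..m*b+L}" for x
    proof -
      \<comment> \<open>The index \<open>b + z\<close> is \<open>x / m\<close> rounded up.\<close>
      define z where "z = (x - m*b + (m-1)) div m"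
      have z: "m * z = x - m*b + (m-1) - (x - m*b + (m-1)) mod m"
        by (simp add: z_def minus_mod_eq_mult_div)
      have md: "0 \<le> (x - m*b + (m-1)) mod m" "(x - m*b + (m-1)) mod m < m"
        using assms(2) by simp_all
      have z0: "0 \<le> z" using x assms(2) by (simp add: z_def pos_imp_zdiv_nonneg_iff)
      have "z \<le> L"
      proof (rule ccontr)
        assume "\<not> z \<le> L"
        then have "m * (L + 1) \<le> m * z" using assms(2) by (intro mult_left_mono) auto
        moreover have "0 \<le> L" using x by auto
        then have "1 * L \<le> m * L" using assms(2) by (intro mult_right_mono) auto
        ultimately show False using x z md by (simp add: algebra_simps)
      qed
      with z0 b obtain i where i: "0 \<le> i" "i \<le> k" "b + z + i \<in> A" by force
      have "m * i \<le> m * k" "0 \<le> m * i" using i assms(2) by (simp_all add: mult_left_mono)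
      moreover have "m * (b + z + i) - x = m * i + (m - 1) - (x - m*b + (m-1)) mod m"
        using z by (simp add: distrib_left)
      ultimately have "m * (b + z + i) - x \<in> {0..m*k+m}"
        unfolding atLeastAtMost_iff using md by linarith
      with i(3) show ?thesis by (intro bexI[of _ "m * (b + z + i) - x"]) auto
    qed
    then show "\<exists>b. \<forall>x\<in>{b..b+L}. \<exists>i\<in>{0..m*k+m}. x + i \<in> (*) m ` A" by blast
  qed
qed

text \<open>
  An interval longer than \<open>c + k\<close> that begins near a positive element extends beyond \<open>c\<close>.
\<close>

lemma piecewise_syndetic_unbounded:
  assumes "piecewise_syndetic A" "A \<subseteq> {1..}"
  shows "\<exists>x\<in>A. x > c"
proof -
  obtain k where k: "\<And>L. \<exists>b. \<forall>x\<in>{b..b+L}. \<exists>i\<in>{0..k}. x + i \<in> A"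
    using assms(1) unfolding piecewise_syndetic_def by blast
  from k[of "\<bar>c\<bar> + \<bar>k\<bar> + 1"] obtain b where
    b: "\<forall>x\<in>{b..b+(\<bar>c\<bar> + \<bar>k\<bar> + 1)}. \<exists>i\<in>{0..k}. x + i \<in> A" ..
  then obtain i where "i \<in> {0..k}" "b + i \<in> A" by force
  then have "b \<ge> 1 - k" using assms(2) by force
  moreover obtain j where "j \<in> {0..k}" "b + (\<bar>c\<bar> + \<bar>k\<bar> + 1) + j \<in> A"
    using bspec[OF b, of "b + (\<bar>c\<bar> + \<bar>k\<bar> + 1)"] by auto
  ultimately show ?thesis by (intro bexI) auto
qed

text \<open>
  Colour each point of a long interval by its distance to a nearby element of \<open>A\<close>. A monochromatic
  configuration \<open>a\<close>, \<open>a + p d\<close> becomes, after adding the common distance, a configuration inside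
  \<open>A\<close>. Configurations of bounded size occur near every point of the interval, so the union of the
  sets of returns over the finitely many \<open>d \<le> N\<close> is piecewise syndetic, hence so is one of them.
\<close>

theorem piecewise_syndetic_polynomial_return:
  assumes A: "piecewise_syndetic A" and F: "finite F" "\<And>p. p \<in> F \<Longrightarrow> poly p 0 = 0"
  shows "\<exists>n\<ge>1. piecewise_syndetic {x \<in> A. \<forall>p\<in>F. x + poly p n \<in> A}"
proof -
  define R where "R n = {x \<in> A. \<forall>p\<in>F. x + poly p n \<in> A}" for n
  obtain k where k: "\<And>L. \<exists>b. \<forall>x\<in>{b..b+L}. \<exists>i\<in>{0..k}. x + i \<in> A"
    using A unfolding piecewise_syndetic_def by blast
  obtain N where N: "\<forall>\<chi> :: int \<Rightarrow> nat. (\<forall>x. \<chi> x < nat k + 1) \<longrightarrow>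
      (\<exists>a d. \<bar>a\<bar> \<le> N \<and> 1 \<le> d \<and> d \<le> N \<and> (\<forall>p\<in>F. \<chi> (a + poly p d) = \<chi> a))"
    by (rule poly_vdwE[OF polynomial_van_der_Waerden[OF F], of "nat k + 1"])
  obtain M where M: "M \<ge> 0" "\<And>p d. p \<in> F \<Longrightarrow> 1 \<le> d \<Longrightarrow> d \<le> N \<Longrightarrow> \<bar>poly p d\<bar> \<le> M"
    using poly_bound_on_interval[OF F(1)] by metis
  define W where "W = \<bar>N\<bar> + M"
  have "piecewise_syndetic (\<Union>n\<in>{1..N}. R n)" unfolding piecewise_syndetic_def
  proof (rule exI[of _ "2 * W + k"], rule allI)
    fix L
    from k[of "L + 2 * W"] obtain b where
      "\<forall>x\<in>{b..b+(L+2*W)}. \<exists>i\<in>{0..k}. x + i \<in> A" ..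
    then obtain f where f: "\<And>x. x \<in> {b..b+(L+2*W)} \<Longrightarrow> f x \<in> {0..k} \<and> x + f x \<in> A" by metis
    have "\<exists>i\<in>{0..2*W+k}. x + i \<in> (\<Union>n\<in>{1..N}. R n)" if x: "x \<in> {b..b+L}" for x
    proof -
      \<comment> \<open>The colouring is centred at \<open>x + W\<close>, which keeps everything it uses to the right of \<open>x\<close>.\<close>
      define \<chi> where "\<chi> t = nat (if \<bar>t\<bar> \<le> W then f (x + W + t) else 0)" for t
      have fW: "f (x + W + t) \<in> {0..k} \<and> x + W + t + f (x + W + t) \<in> A" if "\<bar>t\<bar> \<le> W" for t
        using that x by (intro f) (auto simp: abs_le_iff)
      have "\<chi> t < nat k + 1" for t using fW[of t] by (auto simp: \<chi>_def)
      then have "\<forall>t. \<chi> t < nat k + 1" ..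
      from mp[OF spec[OF N] this] obtain a d where a: "\<bar>a\<bar> \<le> N" and d: "1 \<le> d" "d \<le> N"
        and eq: "\<And>p. p \<in> F \<Longrightarrow> \<chi> (a + poly p d) = \<chi> a" by blast
      have aW: "\<bar>a\<bar> \<le> W" using a M(1) by (simp add: W_def)
      have pW: "\<bar>a + poly p d\<bar> \<le> W" if "p \<in> F" for p using a M(2)[OF that d] by (simp add: W_def)
      define i where "i = f (x + W + a)"
      have i: "i \<in> {0..k}" "x + W + a + i \<in> A" using fW[OF aW] by (auto simp: i_def)
      have "x + W + a + i + poly p d \<in> A" if "p \<in> F" for p
      proof -
        have "f (x + W + (a + poly p d)) = i"
          using eq[OF that] aW pW[OF that] fW[OF aW] fW[OF pW[OF that]]
          by (simp add: \<chi>_def i_def eq_nat_nat_iff)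
        with fW[OF pW[OF that]] show ?thesis by (simp add: algebra_simps)
      qed
      with i(2) have "x + (W + a + i) \<in> R d" by (simp add: R_def add.assoc)
      moreover have "W + a + i \<in> {0..2*W+k}" using aW i(1) by (auto simp: abs_le_iff)
      ultimately show ?thesis using d by (intro bexI[of _ "W + a + i"]) auto
    qed
    then show "\<exists>b. \<forall>x\<in>{b..b+L}. \<exists>i\<in>{0..2*W+k}. x + i \<in> (\<Union>n\<in>{1..N}. R n)" by blast
  qed
  then obtain n where "n \<in> {1..N}" "piecewise_syndetic (R n)"
    using piecewise_syndetic_UN[of "{1..N}" R] by auto
  then show ?thesis unfolding R_def by (intro exI[of _ n]) auto
qed

section \<open>Monochromatic sums and products\<close>

text \<open>
  Suppose there is no such class. Then one builds sets \<open>C\<close> of classes of every size, together with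
  a piecewise syndetic set \<open>B\<close> and scales \<open>Y E\<close> such that \<open>B\<close> lies in \<open>(Y E)\<^sup>s\<close> times \<open>E\<close> for
  all \<open>E \<in> C\<close>; this is absurd once \<open>C\<close> is larger than the cover. Let \<open>D\<close> be the points of \<open>B\<close>
  that return to \<open>B\<close> after adding \<open>(Y E)\<^sup>s f (Y E n)\<close> for all \<open>E \<in> C\<close> and \<open>f \<in> G\<close>, and let
  \<open>E\<close> be a class with piecewise syndetic intersection with \<open>n\<^sup>s D\<close>. If \<open>E\<close> is new it joins
  \<open>C\<close> with scale 1 and the other scales are multiplied by \<open>n\<close>. If \<open>E\<close> is already in \<open>C\<close>, take
  \<open>v\<close> in that intersection, put \<open>y = Y E n\<close>, and write \<open>v = n\<^sup>s u\<close> and \<open>u = (Y E)\<^sup>s x\<close>: then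
  \<open>x\<close> and \<open>x y\<^sup>s = v\<close> lie in \<open>E\<close>, and since \<open>u + (Y E)\<^sup>s f y\<close> lies in \<open>B\<close>, dividing by
  \<open>(Y E)\<^sup>s\<close> shows \<open>x + f y \<in> E\<close>.
\<close>

theorem monochromatic_sums_and_products:
  fixes \<E> :: "int set set" and G :: "int poly set"
  assumes \<E>: "finite \<E>" "\<Union>\<E> = {1..}" and G: "finite G" "\<And>f. f \<in> G \<Longrightarrow> poly f 0 = 0"
  shows "\<exists>E\<in>\<E>. \<exists>x y. x > y \<and> y \<ge> 2 \<and> x \<in> E \<and> x * y ^ s \<in> E \<and> (\<forall>f\<in>G. x + poly f y \<in> E)"
proof (rule ccontr)
  assume none: "\<not> ?thesis"
  have "\<exists>C Y B. C \<subseteq> \<E> \<and> card C = j \<and> piecewise_syndetic B \<and> B \<subseteq> {1..} \<and>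
      (\<forall>E\<in>C. Y E \<ge> 1 \<and> (\<forall>b\<in>B. \<exists>x\<in>E. b = Y E ^ s * x))" for j :: nat
  proof (induction j)
    case 0
    show ?case using piecewise_syndetic_positive
      by (intro exI[of _ "{}"] exI[of _ "\<lambda>_. 1"] exI[of _ "{1..}"]) simp
  next
    case (Suc j)
    then obtain C Y B where C: "C \<subseteq> \<E>" "card C = j" and B: "piecewise_syndetic B" "B \<subseteq> {1..}"
      and CB: "\<forall>E\<in>C. Y E \<ge> 1 \<and> (\<forall>b\<in>B. \<exists>x\<in>E. b = Y E ^ s * x)"
      by blast
    have Y: "\<And>E. E \<in> C \<Longrightarrow> Y E \<ge> 1" "\<And>E b. E \<in> C \<Longrightarrow> b \<in> B \<Longrightarrow> \<exists>x\<in>E. b = Y E ^ s * x"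
      using CB by blast+
    have fC: "finite C" using C \<E> finite_subset by blast
    define F where "F = (\<lambda>(E, f). smult (Y E ^ s) (pcompose f [:0, 2 * Y E:])) ` (C \<times> G)"
    have "finite F" using fC G by (simp add: F_def)
    moreover have "poly p 0 = 0" if "p \<in> F" for p
      using that G(2) by (auto simp: F_def poly_pcompose)
    ultimately have "\<exists>m\<ge>1. piecewise_syndetic {x \<in> B. \<forall>p\<in>F. x + poly p m \<in> B}"
      by (intro piecewise_syndetic_polynomial_return[OF B(1)])
    then obtain m where m: "m \<ge> 1" "piecewise_syndetic {x \<in> B. \<forall>p\<in>F. x + poly p m \<in> B}"
      by blast
    \<comment> \<open>The factor 2, also built into \<open>F\<close>, ensures \<open>y \<ge> 2\<close>.\<close>
    define n where "n = 2 * m"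
    define D where "D = {x \<in> B. \<forall>p\<in>F. x + poly p m \<in> B}"
    have D: "u \<in> B" "u + Y E ^ s * poly f (Y E * n) \<in> B" if "u \<in> D" "E \<in> C" "f \<in> G" for u E f
      using that by (force simp: D_def F_def poly_pcompose n_def algebra_simps)+
    have n: "n \<ge> 2" using m by (simp add: n_def)
    define D' where "D' = (*) (n ^ s) ` D"
    have ns: "n ^ s \<ge> 1" using n by simp
    have D'pos: "D' \<subseteq> {1..}"
    proof
      fix v assume "v \<in> D'"
      then obtain u where "u \<in> B" "v = n ^ s * u" by (auto simp: D'_def D_def)
      then show "v \<in> {1..}" using B(2) ns by (auto simp: int_one_le_iff_zero_less)
    qed
    have "piecewise_syndetic D'"
      unfolding D'_def using m(2) ns by (intro piecewise_syndetic_dilate) (simp_all add: D_def)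
    moreover have "D' = (\<Union>E\<in>\<E>. D' \<inter> E)" using D'pos \<E>(2) by blast
    ultimately obtain E where E: "E \<in> \<E>" "piecewise_syndetic (D' \<inter> E)"
      using piecewise_syndetic_UN[OF \<E>(1), of "\<lambda>E. D' \<inter> E"] by auto
    have "E \<notin> C"
    proof
      assume EC: "E \<in> C"
      define y where "y = Y E * n"
      have Y1: "Y E \<ge> 1" using Y(1)[OF EC] .
      have y: "y \<ge> 2" using mult_mono[of 1 "Y E" 2 n] Y1 n by (simp add: y_def)
      \<comment> \<open>Choosing \<open>v\<close> beyond this bound forces \<open>x > y\<close>.\<close>
      obtain v where v: "v \<in> D'" "v \<in> E" "v > y * y ^ s"
        using piecewise_syndetic_unbounded[OF E(2)] D'pos by blast
      then obtain u where u: "u \<in> D" "v = n ^ s * u" by (auto simp: D'_def)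
      then have "u \<in> B" by (simp add: D_def)
      then obtain x where x: "x \<in> E" "u = Y E ^ s * x" using Y(2)[OF EC] by blast
      have v_eq: "v = x * y ^ s" by (simp add: u x y_def power_mult_distrib)
      then have "x > y" using v(3) y by simp
      moreover have "x + poly f y \<in> E" if "f \<in> G" for f
      proof -
        have "u + Y E ^ s * poly f y \<in> B" using D(2)[OF u(1) EC that] by (simp add: y_def)
        then obtain z where z: "z \<in> E" "u + Y E ^ s * poly f y = Y E ^ s * z"
          using Y(2)[OF EC] by blast
        then have "Y E ^ s * (x + poly f y) = Y E ^ s * z" by (simp add: x distrib_left)
        then have "x + poly f y = z" using Y1 by simp
        with z(1) show ?thesis by simp
      qed
      ultimately show False using none E(1) x(1) v(2) y v_eq by blast
    qed
    define Y' where "Y' E' = (if E' = E then 1 else Y E' * n)" for E'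
    have "Y' E' \<ge> 1" if "E' \<in> insert E C" for E'
      using that Y(1)[of E'] n mult_mono[of 1 "Y E'" 1 n] by (auto simp: Y'_def)
    moreover have "\<exists>x\<in>E'. b = Y' E' ^ s * x" if E': "E' \<in> insert E C" and b: "b \<in> D' \<inter> E" for E' b
    proof (cases "E' = E")
      case True
      with b show ?thesis by (simp add: Y'_def)
    next
      case False
      obtain u where u: "u \<in> B" "b = n ^ s * u" using b by (auto simp: D'_def D_def)
      moreover have "E' \<in> C" using False E' by simp
      ultimately obtain x where "x \<in> E'" "u = Y E' ^ s * x" using Y(2) by blast
      with u False show ?thesis by (intro bexI[of _ x]) (simp_all add: Y'_def power_mult_distrib)
    qed
    moreover have "card (insert E C) = Suc j" using \<open>E \<notin> C\<close> C fC by simp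
    ultimately show ?case using E C(1) D'pos
      by (intro exI[of _ "insert E C"] exI[of _ Y'] exI[of _ "D' \<inter> E"]) auto
  qed
  from this[of "Suc (card \<E>)"] obtain C where "C \<subseteq> \<E>" "card C = Suc (card \<E>)" by blast
  with card_mono[OF \<E>(1), of C] show False by simp
qed

section \<open>The density\<close>

text \<open>
  The characteristic function of the complement of the ideal generated by \<open>\<B>\<close>.
\<close>

definition ideal_density :: "nat set set \<Rightarrow> nat set \<Rightarrow> real" where
  "ideal_density \<B> A = (if \<exists>\<F>. finite \<F> \<and> \<F> \<subseteq> \<B> \<and> A \<subseteq> \<Union>\<F> then 0 else 1)"

lemma subadditive_ideal_density:
  assumes "\<And>\<F>. finite \<F> \<Longrightarrow> \<F> \<subseteq> \<B> \<Longrightarrow> \<not> {1..} \<subseteq> \<Union>\<F>"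
  shows "subadditive_density (ideal_density \<B>)"
  unfolding subadditive_density_def
proof (intro conjI allI impI)
  let ?d = "ideal_density \<B>"
  have "?d X = 0 \<or> ?d X = 1" for X
    unfolding ideal_density_def by (split if_split) blast
  then have d01: "0 \<le> ?d X" "?d X \<le> 1" "?d X \<noteq> 0 \<Longrightarrow> ?d X = 1" for X
    by (metis zero_le_one order_refl)+
  show "?d \<in> Pow {1..} \<rightarrow> {0..1}" by (auto simp: ideal_density_def)
  show "?d {} = 0" by (auto simp: ideal_density_def)
  show "?d {1..} = 1" using assms by (auto simp: ideal_density_def)
  show "?d A \<le> ?d B" if "A \<subseteq> B \<and> B \<subseteq> {1..}" for A B
  proof (cases "?d B = 0")
    case True
    then obtain \<F> where "finite \<F>" "\<F> \<subseteq> \<B>" "B \<subseteq> \<Union>\<F>"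
      by (auto simp: ideal_density_def split: if_splits)
    with that have "?d A = 0" unfolding ideal_density_def by (meson subset_trans)
    with True show ?thesis by simp
  next
    case False
    then show ?thesis using d01 by metis
  qed
  show "?d (A \<union> B) \<le> ?d A + ?d B" for A B
  proof (cases "?d A = 0 \<and> ?d B = 0")
    case True
    then obtain \<F> \<G> where "finite \<F>" "\<F> \<subseteq> \<B>" "A \<subseteq> \<Union>\<F>" "finite \<G>" "\<G> \<subseteq> \<B>" "B \<subseteq> \<Union>\<G>"
      by (auto simp: ideal_density_def split: if_splits)
    then have "finite (\<F> \<union> \<G>)" "\<F> \<union> \<G> \<subseteq> \<B>" "A \<union> B \<subseteq> \<Union>(\<F> \<union> \<G>)" by auto
    then have "?d (A \<union> B) = 0" unfolding ideal_density_def by meson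
    with True show ?thesis by simp
  next
    case False
    then have "1 \<le> ?d A + ?d B" using d01[of A] d01[of B] by linarith
    then show ?thesis using d01(2)[of "A \<union> B"] by linarith
  qed
qed

theorem theorem1p1:
  fixes s :: nat
  assumes "s \<ge> 1"
  shows "\<exists>d. subadditive_density d \<and>
    (\<forall>E \<subseteq> {1..}. d E > 0 \<longrightarrow>
      (\<forall>P :: int poly. poly P 0 = 0 \<longrightarrow>
        (\<exists>x y :: nat. x > y \<and> y \<ge> 2 \<and>
          {int x, int x + poly P (int y), int x * int y ^ s} \<subseteq> int ` E)))"
proof -
  define good where "good E P \<longleftrightarrow> (\<exists>x y :: nat. x > y \<and> y \<ge> 2 \<and>
      {int x, int x + poly P (int y), int x * int y ^ s} \<subseteq> int ` E)" for E and P :: "int poly"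
  define \<B> where "\<B> = {E. E \<subseteq> {1..} \<and> (\<exists>P. poly P 0 = 0 \<and> \<not> good E P)}"
  have "\<not> {1..} \<subseteq> \<Union>\<F>" if \<F>: "finite \<F>" "\<F> \<subseteq> \<B>" for \<F>
  proof
    assume cover: "{1..} \<subseteq> \<Union>\<F>"
    from \<F>(2) obtain P where P: "\<And>E. E \<in> \<F> \<Longrightarrow> poly (P E) 0 = 0 \<and> \<not> good E (P E)"
      unfolding \<B>_def by (simp add: subset_iff) metis
    have "\<Union>\<F> = {1..}" using cover \<F>(2) by (auto simp: \<B>_def)
    then have "\<Union>((`) int ` \<F>) = int ` {1..}" by blast
    also have "int ` {1..} = {1..}"
      by (force simp: image_iff intro: bexI[of _ "nat x" for x])
    finally have "\<Union>((`) int ` \<F>) = {1..}" .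
    moreover have "poly f 0 = 0" if "f \<in> P ` \<F>" for f using that P by auto
    ultimately obtain E x y where E: "E \<in> \<F>" "x > y" "y \<ge> 2" "x \<in> int ` E" "x * y ^ s \<in> int ` E"
        "\<forall>f\<in>P ` \<F>. x + poly f y \<in> int ` E"
      using monochromatic_sums_and_products[of "(`) int ` \<F>" "P ` \<F>" s] \<F>(1) by auto
    then have "good E (P E)" unfolding good_def
      by (intro exI[of _ "nat x"] exI[of _ "nat y"]) auto
    with P E(1) show False by blast
  qed
  then have "subadditive_density (ideal_density \<B>)" by (rule subadditive_ideal_density)
  moreover have "good E P" if "E \<subseteq> {1..}" "ideal_density \<B> E > 0" "poly P 0 = 0" for E P
  proof (rule ccontr)
    assume "\<not> good E P"
    then have "finite {E}" "{E} \<subseteq> \<B>" "E \<subseteq> \<Union>{E}" using that by (auto simp: \<B>_def)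
    then have "ideal_density \<B> E = 0" unfolding ideal_density_def by meson
    with that show False by simp
  qed
  ultimately show ?thesis unfolding good_def by blast
qed

end
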